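(* Consider a homogeneous continuous-time Markov chain with finite state space $\mathcal{X}$ and irreducible transition rate matrix $Q$, and a lumping map $\Lambda\colon\mathcal{X}\to\hat{\mathcal{X}}$. Let $f\in\mathcal{L}(\mathcal{X})$ be lumpable with respect to $\Lambda$ and let $\hat f$ be the corresponding element of $\mathcal{L}(\hat{\mathcal{X}})$, i.e. $f(x)=\hat f(\Lambda(x))$ for all $x\in\mathcal{X}$. Then for all $n\in\mathbb{N}\cup\{0\}$ and all real $\delta>0$ such that $\delta\max\{|Q(x,x)|:x\in\mathcal{X}\}<1$, \[ \min\,(I+\delta\underline{\hat Q})^n\hat f\;\le\;E_\infty(f)\;\le\;-\min\,(I+\delta\underline{\hat Q})^n(-\hat f). \] Furthermore, for fixed $\delta$, the lower and upper bounds in this expression become monotonically tighter with increasing $n$ (the lower bound is non-decreasing in $n$ and the upper bound is non-increasing in $n$), and each converges to a (possibly different) constant as $n\to+\infty$.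
   Context: $\mathcal{X}$ is a non-empty finite set; for a finite set $S$, $\mathcal{L}(S)$ is the set of real-valued functions on $S$ (column vectors), and distributions are row vectors. A transition rate matrix $Q$ on $\mathcal{X}$ is a real $|\mathcal{X}|\times|\mathcal{X}|$ matrix with non-negative off-diagonal entries and rows summing to zero; $T_t:=e^{tQ}$. $Q$ is irreducible if $T_t(x,y)>0$ for all $t>0$ and $x,y\in\mathcal{X}$. A homogeneous continuous-time Markov chain $(X_t)_{t\ge0}$ with transition rate matrix $Q$ and initial distribution $\pi_0$ satisfies $E(f(X_t))=\pi_0T_tf$. If $Q$ is irreducible, there is a unique positive distribution $\pi_\infty$ on $\mathcal{X}$ with $\pi_\infty Q=0$, and the limit expectation $E_\infty(f):=\lim_{t\to+\infty}E(f(X_t))$ exists, does not depend on $\pi_0$, and equals $\pi_\infty f$. A lumping map is a surjection $\Lambda\colon\mathcal{X}\to\hat{\mathcal{X}}$ with $1<|\hat{\mathcal{X}}|\le|\mathcal{X}|$; $\Gamma(\hat x):=\{x\in\mathcal{X}:\Lambda(x)=\hat x\}$. A function $f\in\mathcal{L}(\mathcal{X})$ is lumpable with respect to $\Lambda$ if there is $\hat f\in\mathcal{L}(\hat{\mathcal{X}})$ with $f(x)=\hat f(\Lambda(x))$ for all $x\in\mathcal{X}$. The (non-linear) lower transition rate operator $\underline{\hat Q}\colon\mathcal{L}(\hat{\mathcal{X}})\to\mathcal{L}(\hat{\mathcal{X}})$ is \[ [\underline{\hat Q}g](\hat x):=\min\Big\{\sum_{\hat y\in\hat{\mathcal{X}}}g(\hat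 y)\sum_{y\in\Gamma(\hat y)}Q(x,y):x\in\Gamma(\hat x)\Big\},\qquad \hat x\in\hat{\mathcal{X}}. \] $I$ is the identity, the $n$-th power of an operator means $n$ consecutive applications, and $\min g:=\min_{\hat x\in\hat{\mathcal{X}}}g(\hat x)$ for $g\in\mathcal{L}(\hat{\mathcal{X}})$. *)

theory Defs
  imports "HOL-Probability.Probability"
begin

definition transition_rate_matrix :: "real^'x^'x \<Rightarrow> bool" where
  "transition_rate_matrix Q \<longleftrightarrow>
     (\<forall>x y. x \<noteq> y \<longrightarrow> 0 \<le> Q $ x $ y) \<and> (\<forall>x. (\<Sum>y\<in>UNIV. Q $ x $ y) = 0)"

text \<open>Powers with respect to the matrix product; the overloaded \<open>^\<close> on
  this type is the componentwise power.\<close>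

definition mat_power :: "real^'x^'x \<Rightarrow> nat \<Rightarrow> real^'x^'x" where
  "mat_power A n = (((**) A) ^^ n) (mat 1)"

text \<open>The transition matrix \<open>exp (t Q)\<close>, written as the exponential series, because the
  library's \<^const>\<open>exp\<close> is not available for square matrices with the matrix product.\<close>

definition transition_matrix :: "real^'x^'x \<Rightarrow> real \<Rightarrow> real^'x^'x" where
  "transition_matrix Q t = (\<Sum>k. (t ^ k / fact k) *\<^sub>R mat_power Q k)"

definition irreducible_rates :: "real^'x^'x \<Rightarrow> bool" where
  "irreducible_rates Q \<longleftrightarrow> (\<forall>t>0. \<forall>x y. 0 < transition_matrix Q t $ x $ y)"

text \<open>Only the times \<open>t \<ge> 0\<close> of the process \<open>X\<close> matter. In the Markov property, the history
  before the present time \<open>t\<close> is given by the values \<open>u s\<close> at finitely many times \<open>s\<close>; the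
  premise says that the conditioning event has positive probability.\<close>

locale homogeneous_markov_chain = prob_space M for M :: "'w measure" +
  fixes X :: "real \<Rightarrow> 'w \<Rightarrow> 'x::finite" and Q :: "real^'x^'x" and \<pi>0 :: "'x pmf"
  assumes rate_matrix: "transition_rate_matrix Q"
    and random_variable: "\<And>t. 0 \<le> t \<Longrightarrow> X t \<in> measurable M (count_space UNIV)"
    and initial: "\<And>x. \<P>(\<omega> in M. X 0 \<omega> = x) = pmf \<pi>0 x"
    and markov: "\<And>S t d u x y. finite S \<Longrightarrow> S \<subseteq> {0..<t} \<Longrightarrow> 0 \<le> t \<Longrightarrow> 0 \<le> d \<Longrightarrow>
      0 < \<P>(\<omega> in M. X t \<omega> = x \<and> (\<forall>s\<in>S. X s \<omega> = u s)) \<Longrightarrow>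
      \<P>(\<omega> in M. X (t + d) \<omega> = y \<bar> X t \<omega> = x \<and> (\<forall>s\<in>S. X s \<omega> = u s))
        = transition_matrix Q d $ x $ y"

definition limit_expectation ::
    "'w measure \<Rightarrow> (real \<Rightarrow> 'w \<Rightarrow> 'x::finite) \<Rightarrow> real^'x \<Rightarrow> real" where
  "limit_expectation M X f = Lim at_top (\<lambda>t. \<integral>\<omega>. f $ X t \<omega> \<partial>M)"

definition lumping_map :: "('x::finite \<Rightarrow> 'y::finite) \<Rightarrow> bool" where
  "lumping_map \<Lambda> \<longleftrightarrow> surj \<Lambda> \<and> 1 < CARD('y) \<and> CARD('y) \<le> CARD('x)"

definition fibre :: "('x \<Rightarrow> 'y) \<Rightarrow> 'y \<Rightarrow> 'x set" where
  "fibre \<Lambda> xh = {x. \<Lambda> x = xh}"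

definition lower_rate ::
    "real^'x^'x \<Rightarrow> ('x::finite \<Rightarrow> 'y::finite) \<Rightarrow> real^'y \<Rightarrow> real^'y" where
  "lower_rate Q \<Lambda> g =
     (\<chi> xh. MIN x\<in>fibre \<Lambda> xh. \<Sum>yh\<in>UNIV. g $ yh * (\<Sum>y\<in>fibre \<Lambda> yh. Q $ x $ y))"

definition lower_step ::
    "real^'x^'x \<Rightarrow> ('x::finite \<Rightarrow> 'y::finite) \<Rightarrow> real \<Rightarrow> real^'y \<Rightarrow> real^'y" where
  "lower_step Q \<Lambda> \<delta> g = g + \<delta> *\<^sub>R lower_rate Q \<Lambda> g"

definition min_comp :: "real^'y \<Rightarrow> real" where
  "min_comp g = (MIN xh. g $ xh)"

end

theory Submission
  imports Defs
begin

text \<open>All entries of \<open>exp Q\<close> are positive, so it contracts the oscillation of a function by a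
  factor smaller than one. Hence \<open>exp (t Q) v\<close> tends to a constant function, with value
  \<open>c(v)\<close> say, and \<open>c\<close> is linear and monotone. The derivative
  \<open>exp (t Q) Q v\<close> of \<open>exp (t Q) v\<close> converges as well, so its limit is zero,
  that is \<open>c(Q v) = 0\<close>. For \<open>g\<close> on the lumped space, \<open>(I + \<delta> Q)(g \<circ> \<Lambda>)\<close>
  dominates the lift of the lower step of \<open>g\<close>; applying \<open>c\<close> shows that a lower step
  does not increase \<open>c(g \<circ> \<Lambda>)\<close>, and iteration yields the lower bound. The upper bound is
  minus the lower bound for \<open>-f\<close>. The bounds are monotone because \<open>I + \<delta> Q\<close> is
  stochastic when \<open>\<delta>\<close> is small.\<close>

section \<open>Minima of vectors, stochastic matrices and oscillation\<close>

lemma min_comp_le: "min_comp g \<le> g $ x"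
  unfolding min_comp_def by (rule Min_le) auto

lemma min_comp_greatest: "(\<And>x. c \<le> g $ x) \<Longrightarrow> c \<le> min_comp g"
  unfolding min_comp_def by (subst Min_ge_iff) auto

lemma min_comp_attained: "\<exists>x. g $ x = min_comp g"
proof -
  have "min_comp g \<in> range (($) g)"
    unfolding min_comp_def by (rule Min_in) auto
  then show ?thesis by auto
qed

text \<open>The expression \<open>- min_comp (- g)\<close> is the maximum of \<open>g\<close>; facts
  about maxima thus follow from those about minima by negation.\<close>

lemma le_neg_min_comp_neg: "g $ x \<le> - min_comp (- g)"
  using min_comp_le[of "- g" x] by simp

definition stochastic :: "real^'x^'x \<Rightarrow> bool" where
  "stochastic P \<longleftrightarrow> (\<forall>x y. 0 \<le> P $ x $ y) \<and> (\<forall>x. (\<Sum>y\<in>UNIV. P $ x $ y) = 1)"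

text \<open>Each entry of \<open>P *v v\<close> is a convex combination of entries of
  \<open>v\<close>.\<close>

lemma stochastic_min_comp_mono:
  assumes "stochastic P"
  shows "min_comp v \<le> min_comp (P *v v)"
proof (rule min_comp_greatest)
  fix x
  have "min_comp v = (\<Sum>y\<in>UNIV. P $ x $ y * min_comp v)"
    using assms by (simp add: stochastic_def flip: sum_distrib_right)
  also have "\<dots> \<le> (\<Sum>y\<in>UNIV. P $ x $ y * v $ y)"
    using assms by (intro sum_mono mult_left_mono min_comp_le) (auto simp: stochastic_def)
  finally show "min_comp v \<le> (P *v v) $ x"
    by (simp add: matrix_vector_mult_def)
qed

lemma matrix_vector_mult_minus: "P *v (- v) = - (P *v (v :: real^'n))"
  by (simp add: vec_eq_iff matrix_vector_mult_def sum_negf)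

lemma stochastic_max_comp_mono:
  assumes "stochastic P"
  shows "- min_comp (- (P *v v)) \<le> - min_comp (- v)"
  using stochastic_min_comp_mono[OF assms, of "- v"] by (simp add: matrix_vector_mult_minus)

definition osc :: "real^'x \<Rightarrow> real" where
  "osc v = - min_comp (- v) - min_comp v"

lemma osc_nonneg: "0 \<le> osc v"
  using min_comp_le[of v undefined] le_neg_min_comp_neg[of v undefined] by (simp add: osc_def)

text \<open>Every row puts weight at least \<open>\<epsilon>\<close> on a minimiser \<open>z\<close>
  of \<open>v\<close>. This pulls each average at least \<open>\<epsilon> * osc v\<close> below the
  maximum of \<open>v\<close>, while the minimum cannot drop.\<close>

lemma stochastic_osc_contraction:
  assumes P: "stochastic P" and e: "\<And>x y. \<epsilon> \<le> P $ x $ y"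
  shows "osc (P *v v) \<le> (1 - \<epsilon>) * osc v"
proof -
  obtain z where z: "v $ z = min_comp v"
    using min_comp_attained by blast
  let ?M = "- min_comp (- v)"
  have "- (?M - \<epsilon> * osc v) \<le> min_comp (- (P *v v))"
  proof (rule min_comp_greatest)
    fix x
    have "\<epsilon> * osc v \<le> P $ x $ z * (?M - v $ z)"
      using e osc_nonneg[of v] by (simp add: z osc_def[symmetric] mult_right_mono)
    also have "\<dots> \<le> (\<Sum>y\<in>UNIV. P $ x $ y * (?M - v $ y))"
      using P le_neg_min_comp_neg[of v]
      by (intro member_le_sum) (auto simp: stochastic_def intro!: mult_nonneg_nonneg)
    also have "\<dots> = ?M * (\<Sum>y\<in>UNIV. P $ x $ y) - (P *v v) $ x"
      by (simp add: matrix_vector_mult_def right_diff_distrib sum_subtractf sum_negf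
          sum_distrib_left sum.distrib mult.commute)
    also have "\<dots> = ?M - (P *v v) $ x"
      using P by (simp add: stochastic_def)
    finally show "- (?M - \<epsilon> * osc v) \<le> (- (P *v v)) $ x"
      by simp
  qed
  then show ?thesis
    using stochastic_min_comp_mono[OF P, of v] by (simp add: osc_def algebra_simps)
qed

section \<open>The matrix exponential series and its derivative\<close>

lemma mat_power_0: "mat_power A 0 = mat 1"
  by (simp add: mat_power_def)

lemma mat_power_Suc: "mat_power A (Suc n) = A ** mat_power A n"
  by (simp add: mat_power_def)

lemma mat_power_Suc_right: "mat_power A (Suc n) = mat_power A n ** A"
proof (induction n)
  case (Suc n)
  then show ?case by (metis mat_power_Suc matrix_mul_assoc)
qed (simp add: mat_power_def)

text \<open>Each absolute row sum is at most the sum \<open>?B\<close> over all entries, so a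
  further factor \<open>Q\<close> costs at most a factor \<open>?B\<close>. The bound dominates the
  exponential series.\<close>

lemma mat_power_entry_bound:
  fixes Q :: "real^'x^'x"
  shows "\<bar>mat_power Q n $ x $ y\<bar> \<le> (\<Sum>x\<in>UNIV. \<Sum>y\<in>UNIV. \<bar>Q $ x $ y\<bar>) ^ n" (is "_ \<le> ?B ^ n")
proof (induction n arbitrary: x)
  case 0
  then show ?case by (simp add: mat_power_0 mat_def)
next
  case (Suc n)
  have B: "0 \<le> ?B" by (simp add: sum_nonneg)
  have "\<bar>mat_power Q (Suc n) $ x $ y\<bar> \<le> (\<Sum>z\<in>UNIV. \<bar>Q $ x $ z * mat_power Q n $ z $ y\<bar>)"
    by (simp add: mat_power_Suc matrix_matrix_mult_def sum_abs)
  also have "\<dots> \<le> (\<Sum>z\<in>UNIV. \<bar>Q $ x $ z\<bar> * ?B ^ n)"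
    by (intro sum_mono) (simp add: abs_mult Suc mult_left_mono)
  also have "\<dots> = (\<Sum>z\<in>UNIV. \<bar>Q $ x $ z\<bar>) * ?B ^ n"
    by (simp add: sum_distrib_right)
  also have "\<dots> \<le> ?B * ?B ^ n"
    using B by (intro mult_right_mono member_le_sum) (auto intro: sum_nonneg)
  finally show ?case by simp
qed

text \<open>The terms have the form coefficient times \<open>t ^ k\<close>, so that theorems on real
  power series apply to each entry.\<close>

lemma summable_transition_series:
  "summable (\<lambda>k. mat_power Q k $ x $ y / fact k * t ^ k)"
proof (rule summable_comparison_test')
  let ?B = "\<Sum>x\<in>UNIV. \<Sum>y\<in>UNIV. \<bar>Q $ x $ y\<bar>"
  show "summable (\<lambda>k. inverse (fact k) * (?B * \<bar>t\<bar>) ^ k)"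
    by (rule summable_exp)
  show "norm (mat_power Q k $ x $ y / fact k * t ^ k) \<le> inverse (fact k) * (?B * \<bar>t\<bar>) ^ k" for k
    using mat_power_entry_bound[of Q k x y]
    by (auto simp: abs_mult power_abs power_mult_distrib divide_inverse mult_ac
        intro!: mult_left_mono)
qed

text \<open>Convergence of matrices is entrywise, so the limit of the matrix series can be read off
  from its entries.\<close>

lemma transition_matrix_nth:
  "transition_matrix Q t $ x $ y = (\<Sum>k. mat_power Q k $ x $ y / fact k * t ^ k)"
proof -
  let ?S = "\<chi> x y. \<Sum>k. mat_power Q k $ x $ y / fact k * t ^ k"
  have "(\<lambda>k. (t ^ k / fact k) *\<^sub>R mat_power Q k) sums ?S"
    unfolding sums_def
  proof (intro vec_tendstoI)
    fix x y
    show "(\<lambda>n. (\<Sum>k<n. (t ^ k / fact k) *\<^sub>R mat_power Q k) $ x $ y) \<longlonglongrightarrow> ?S $ x $ y"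
      using summable_LIMSEQ[OF summable_transition_series[of Q x y t]]
      by (simp add: mult.commute)
  qed
  then have "transition_matrix Q t = ?S"
    unfolding transition_matrix_def by (rule sums_unique[symmetric])
  then show ?thesis by simp
qed

lemma transition_matrix_0: "transition_matrix Q 0 = mat 1"
  unfolding vec_eq_iff transition_matrix_nth powser_zero by (simp add: mat_power_0)

text \<open>Termwise differentiation: the factor \<open>Suc k\<close> cancels against the factorial,
  which leaves a shift of the matrix power.\<close>

lemma transition_matrix_has_derivative_series:
  "((\<lambda>t. transition_matrix Q t $ x $ y) has_real_derivative
     (\<Sum>k. mat_power Q (Suc k) $ x $ y / fact k * t ^ k)) (at t)"
proof -
  have "((\<lambda>t. \<Sum>k. mat_power Q k $ x $ y / fact k * t ^ k) has_real_derivative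
      (\<Sum>k. diffs (\<lambda>k. mat_power Q k $ x $ y / fact k) k * t ^ k)) (at t)"
    by (rule termdiffs_strong_converges_everywhere) (rule summable_transition_series)
  moreover have "diffs (\<lambda>k. mat_power Q k $ x $ y / fact k) k = mat_power Q (Suc k) $ x $ y / fact k" for k
    by (simp add: diffs_def)
  ultimately show ?thesis by (simp add: transition_matrix_nth)
qed

text \<open>Kolmogorov's backward equation, obtained by splitting \<open>Q\<close> off on the left
  of each power. Splitting on the right gives the forward equation; the semigroup law uses
  both.\<close>

lemma transition_matrix_has_derivative_left:
  "((\<lambda>t. transition_matrix Q t $ x $ y) has_real_derivative
     (Q ** transition_matrix Q t) $ x $ y) (at t)"
proof -
  have "(\<Sum>k. mat_power Q (Suc k) $ x $ y / fact k * t ^ k)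
      = (\<Sum>k. \<Sum>z\<in>UNIV. Q $ x $ z * (mat_power Q k $ z $ y / fact k * t ^ k))"
    by (simp add: mat_power_Suc matrix_matrix_mult_def sum_divide_distrib sum_distrib_left mult_ac)
  also have "\<dots> = (\<Sum>z\<in>UNIV. Q $ x $ z * transition_matrix Q t $ z $ y)"
    unfolding transition_matrix_nth
    by (subst suminf_sum)
      (intro sum.cong refl suminf_mult summable_mult summable_transition_series)+
  finally show ?thesis
    using transition_matrix_has_derivative_series[of Q x y t] by (simp add: matrix_matrix_mult_def)
qed

lemma transition_matrix_has_derivative_right:
  "((\<lambda>t. transition_matrix Q t $ x $ y) has_real_derivative
     (transition_matrix Q t ** Q) $ x $ y) (at t)"
proof -
  have "(\<Sum>k. mat_power Q (Suc k) $ x $ y / fact k * t ^ k)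
      = (\<Sum>k. \<Sum>z\<in>UNIV. (mat_power Q k $ x $ z / fact k * t ^ k) * Q $ z $ y)"
    by (simp add: mat_power_Suc_right matrix_matrix_mult_def sum_divide_distrib sum_distrib_left mult_ac)
  also have "\<dots> = (\<Sum>z\<in>UNIV. transition_matrix Q t $ x $ z * Q $ z $ y)"
    unfolding transition_matrix_nth
    by (subst suminf_sum)
      (intro sum.cong refl suminf_mult2[symmetric] summable_mult2 summable_transition_series)+
  finally show ?thesis
    using transition_matrix_has_derivative_series[of Q x y t] by (simp add: matrix_matrix_mult_def)
qed

text \<open>In the forward form the derivative is again the semigroup applied to a fixed vector, so
  convergence results for arbitrary vectors also cover derivatives.\<close>

lemma transition_matrix_vec_has_derivative:
  "((\<lambda>t. (transition_matrix Q t *v v) $ x) has_real_derivative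
     (transition_matrix Q t *v (Q *v v)) $ x) (at t)"
proof -
  have "((\<lambda>t. \<Sum>y\<in>UNIV. transition_matrix Q t $ x $ y * v $ y) has_real_derivative
     (\<Sum>y\<in>UNIV. (transition_matrix Q t ** Q) $ x $ y * v $ y)) (at t)"
    by (intro DERIV_sum DERIV_cmult_right transition_matrix_has_derivative_right)
  then show ?thesis
    by (simp add: matrix_vector_mul_assoc) (simp add: matrix_vector_mult_def)
qed

section \<open>Semigroup law and stochasticity\<close>

lemma matrix_mult_nth: "(A ** B) $ x $ z = (\<Sum>y\<in>UNIV. A $ x $ y * B $ y $ z)"
  by (simp add: matrix_matrix_mult_def)

text \<open>The entries of \<open>?T r ** ?T (s + t - r)\<close> do not depend on \<open>r\<close>:
  differentiating either factor puts \<open>Q\<close> between the two, with opposite signs. The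
  values \<open>r = 0\<close> and \<open>r = s\<close> give the two sides.\<close>

lemma transition_matrix_add:
  "transition_matrix Q (s + t) = transition_matrix Q s ** transition_matrix Q t"
proof -
  let ?T = "transition_matrix Q"
  have "?T (s + t) $ x $ z = (?T s ** ?T t) $ x $ z" for x z
  proof -
    define \<phi> where "\<phi> r = (\<Sum>y\<in>UNIV. ?T r $ x $ y * ?T (s + t - r) $ y $ z)" for r
    have "(\<phi> has_real_derivative 0) (at r)" for r
    proof -
      have neg: "((\<lambda>r. ?T (s + t - r) $ y $ z) has_real_derivative
          - (Q ** ?T (s + t - r)) $ y $ z) (at r)" for y
        by (rule DERIV_cong[OF DERIV_chain2[OF transition_matrix_has_derivative_left]])
          (auto intro!: derivative_eq_intros)
      have "(\<phi> has_real_derivative (\<Sum>y\<in>UNIV. (?T r ** Q) $ x $ y * ?T (s + t - r) $ y $ z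
          + - (Q ** ?T (s + t - r)) $ y $ z * ?T r $ x $ y)) (at r)"
        unfolding \<phi>_def by (intro DERIV_sum DERIV_mult transition_matrix_has_derivative_right neg)
      moreover have "(\<Sum>y\<in>UNIV. (?T r ** Q) $ x $ y * ?T (s + t - r) $ y $ z)
          = (\<Sum>y\<in>UNIV. ?T r $ x $ y * (Q ** ?T (s + t - r)) $ y $ z)"
        using arg_cong[OF matrix_mul_assoc[of "?T r" Q "?T (s + t - r)"], of "\<lambda>A. A $ x $ z"]
        by (simp only: matrix_mult_nth[of "?T r ** Q"] matrix_mult_nth[of "?T r" "Q ** _"])
      ultimately show ?thesis
        by (simp add: sum_subtractf mult.commute)
    qed
    then have "\<phi> 0 = \<phi> s"
      by (rule DERIV_isconst_all[rule_format])
    then show ?thesis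
      by (simp add: \<phi>_def transition_matrix_0 matrix_matrix_mult_def mat_def if_distrib
          if_distribR sum.delta cong: if_cong)
  qed
  then show ?thesis by (simp add: vec_eq_iff)
qed

lemma rate_matrix_mult_const:
  assumes "transition_rate_matrix Q"
  shows "Q *v (\<chi> x. c) = 0"
  using assms by (simp add: transition_rate_matrix_def vec_eq_iff matrix_vector_mult_def
      flip: sum_distrib_right)

text \<open>Row sums are the image of the constant 1, which \<open>Q\<close> annihilates; they keep
  their value at time 0.\<close>

lemma transition_matrix_row_sum:
  assumes "transition_rate_matrix Q"
  shows "(\<Sum>y\<in>UNIV. transition_matrix Q t $ x $ y) = 1"
proof -
  let ?f = "\<lambda>t. (transition_matrix Q t *v (\<chi> x. 1)) $ x"
  have "(?f has_real_derivative 0) (at t)" for t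
    using transition_matrix_vec_has_derivative[of Q "\<chi> x. 1" x t]
    by (simp add: rate_matrix_mult_const[OF assms])
  then have "?f t = ?f 0"
    by (intro DERIV_isconst_all[rule_format]) auto
  then show ?thesis
    by (simp add: transition_matrix_0) (simp add: matrix_vector_mult_def)
qed

lemma stochastic_transition_matrix:
  assumes "transition_rate_matrix Q" "irreducible_rates Q" "0 \<le> t"
  shows "stochastic (transition_matrix Q t)"
\<comment> \<open>Irreducibility gives positive entries only for \<open>t > 0\<close>; at time 0 the
  matrix is the identity.\<close>
proof (cases "t = 0")
  case False
  then show ?thesis
    using assms by (auto simp: stochastic_def transition_matrix_row_sum irreducible_rates_def less_imp_le)
qed (auto simp: stochastic_def transition_matrix_row_sum[OF assms(1)] transition_matrix_0 mat_def)

section \<open>Convergence of the semigroup to constants\<close>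

lemma transition_matrix_tendsto:
  assumes Q: "transition_rate_matrix Q" "irreducible_rates Q"
  obtains c where "\<And>x. ((\<lambda>t. (transition_matrix Q t *v v) $ x) \<longlongrightarrow> c) at_top"
proof -
  let ?T = "transition_matrix Q"
  \<comment> \<open>Integer times suffice: the range \<open>lo n\<close> to \<open>hi n\<close> at
    time \<open>n\<close> encloses all later values.\<close>
  define w where "w n = ?T (real n) *v v" for n
  define lo where "lo n = min_comp (w n)" for n
  define hi where "hi n = - min_comp (- w n)" for n
  define \<epsilon> where "\<epsilon> = (MIN (x, y). ?T 1 $ x $ y)"
  \<comment> \<open>For \<open>real n \<le> t\<close> the matrix on the right is stochastic, so no
    entry leaves the range reached at time \<open>n\<close>.\<close>
  have shift: "?T t *v v = ?T (t - real n) *v w n" for t n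
    using transition_matrix_add[of Q "t - real n" "real n"]
    by (simp add: w_def matrix_vector_mul_assoc)
  have stoch: "stochastic (?T t)" if "0 \<le> t" for t
    using Q that by (rule stochastic_transition_matrix)
  have \<epsilon>_le: "\<epsilon> \<le> ?T 1 $ x $ y" for x y
    unfolding \<epsilon>_def by (rule Min_le) (auto intro: rev_image_eqI[of "(x, y)"])
  have "\<epsilon> \<in> range (\<lambda>(x, y). ?T 1 $ x $ y)"
    unfolding \<epsilon>_def by (rule Min_in) auto
  then have \<epsilon>_pos: "0 < \<epsilon>"
    using Q(2) by (auto simp: irreducible_rates_def)
  have "?T 1 $ x $ x \<le> (\<Sum>y\<in>UNIV. ?T 1 $ x $ y)" for x
    using stoch[of 1] by (intro member_le_sum) (auto simp: stochastic_def)
  then have \<epsilon>_le_1: "\<epsilon> \<le> 1"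
    using \<epsilon>_le[of undefined undefined] order_trans transition_matrix_row_sum[OF Q(1)] by metis
  have bounds: "lo n \<le> (?T t *v v) $ x" "(?T t *v v) $ x \<le> hi n" if "real n \<le> t" for n t x
    unfolding lo_def hi_def shift[of t n]
    using that stochastic_min_comp_mono[OF stoch, of "t - real n" "w n"]
      stochastic_max_comp_mono[OF stoch, of "t - real n" "w n"]
      min_comp_le[of "?T (t - real n) *v w n" x]
      le_neg_min_comp_neg[of "?T (t - real n) *v w n" x]
    by auto
  have inc: "incseq lo"
    unfolding lo_def using bounds(1)
    by (intro monoI min_comp_greatest) (auto simp: lo_def w_def)
  have lo_hi: "lo m \<le> hi n" for m n
  proof -
    let ?t = "real (max m n)"
    show ?thesis
      using bounds(1)[of m ?t undefined] bounds(2)[of n ?t undefined] by simp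
  qed
  \<comment> \<open>The limit of the minima lies below every \<open>hi n\<close> too, so it is the
    candidate for all states at once.\<close>
  obtain c where c: "lo \<longlonglongrightarrow> c" "\<And>n. lo n \<le> c"
    using incseq_convergent[OF inc, of "hi 0"] lo_hi by blast
  have c_hi: "c \<le> hi n" for n
    using LIMSEQ_le_const2[OF c(1)] lo_hi by blast
  \<comment> \<open>Each unit of time multiplies the oscillation by at most
    \<open>1 - \<epsilon>\<close>.\<close>
  have gap: "hi n - lo n \<le> (1 - \<epsilon>) ^ n * osc v" for n
  proof (induction n)
    case 0
    then show ?case by (simp add: hi_def lo_def w_def osc_def transition_matrix_0)
  next
    case (Suc n)
    have "w (Suc n) = ?T 1 *v w n"
      using shift[of "real (Suc n)" n] by (simp add: w_def)
    then have "hi (Suc n) - lo (Suc n) \<le> (1 - \<epsilon>) * (hi n - lo n)"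
      using stochastic_osc_contraction[OF stoch \<epsilon>_le, of "w n"]
      by (simp add: hi_def lo_def osc_def)
    also have "\<dots> \<le> (1 - \<epsilon>) * ((1 - \<epsilon>) ^ n * osc v)"
      using Suc \<epsilon>_le_1 by (intro mult_left_mono) auto
    finally show ?case by simp
  qed
  have gap_0: "(\<lambda>n. (1 - \<epsilon>) ^ n * osc v) \<longlonglongrightarrow> 0"
    using \<epsilon>_pos \<epsilon>_le_1 by (intro tendsto_mult_left_zero LIMSEQ_realpow_zero) auto
  have "((\<lambda>t. (?T t *v v) $ x) \<longlongrightarrow> c) at_top" for x
  proof (rule tendstoI)
    fix e :: real assume "0 < e"
    then obtain n where n: "(1 - \<epsilon>) ^ n * osc v < e"
      using order_tendstoD(2)[OF gap_0] by (auto simp: eventually_sequentially)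
    \<comment> \<open>Both points lie between \<open>lo n\<close> and \<open>hi n\<close>, which are
      less than \<open>e\<close> apart.\<close>
    have "dist ((?T t *v v) $ x) c < e" if "real n \<le> t" for t
      using bounds[OF that, of x] c(2)[of n] c_hi[of n] gap[of n] n
      by (auto simp: dist_real_def)
    then show "\<forall>\<^sub>F t in at_top. dist ((?T t *v v) $ x) c < e"
      by (auto simp: eventually_at_top_linorder)
  qed
  then show thesis by (rule that)
qed

text \<open>By the mean value theorem, unit increments of \<open>g\<close> are values of
  \<open>g'\<close> at points tending to infinity. The increments tend to \<open>a - a\<close>, the
  values to \<open>b\<close>.\<close>

lemma tendsto_derivative_zero:
  fixes g g' :: "real \<Rightarrow> real"
  assumes der: "\<And>t. (g has_real_derivative g' t) (at t)"
    and g: "(g \<longlongrightarrow> a) at_top" and g': "(g' \<longlongrightarrow> b) at_top"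
  shows "b = 0"
proof -
  have "\<exists>\<xi>>t. g (t + 1) - g t = g' \<xi>" for t
    using MVT2[of t "t + 1" g g'] der by force
  then obtain \<xi> where \<xi>: "\<And>t. t < \<xi> t" "\<And>t. g (t + 1) - g t = g' (\<xi> t)"
    by metis
  have "filterlim \<xi> at_top at_top"
    by (rule filterlim_at_top_mono[OF filterlim_ident]) (simp add: less_imp_le \<xi>(1))
  with g' have "((\<lambda>t. g' (\<xi> t)) \<longlongrightarrow> b) at_top"
    by (rule filterlim_compose)
  moreover have "((\<lambda>t. g (t + 1) - g t) \<longlongrightarrow> a - a) at_top"
    by (intro tendsto_diff g filterlim_compose[OF g] filterlim_at_top_mono[OF filterlim_ident]) simp
  ultimately show "b = 0"
    using tendsto_unique[OF trivial_limit_at_top_linorder] by (simp add: \<xi>(2))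
qed

text \<open>This expresses invariance of the limiting distribution. Convergence for \<open>v\<close>
  and for \<open>Q *v v\<close> is convergence of a function and of its derivative.\<close>

lemma transition_matrix_rate_tendsto_0:
  assumes "transition_rate_matrix Q" "irreducible_rates Q"
  shows "((\<lambda>t. (transition_matrix Q t *v (Q *v v)) $ x) \<longlongrightarrow> 0) at_top"
  using tendsto_derivative_zero[OF transition_matrix_vec_has_derivative]
    transition_matrix_tendsto[OF assms] by metis

section \<open>The lower step on the lumped space\<close>

lemma lower_step_nth:
  fixes Q :: "real^'x^'x" and \<Lambda> :: "'x::finite \<Rightarrow> 'y::finite"
  assumes "surj \<Lambda>" "0 \<le> \<delta>"
  shows "lower_step Q \<Lambda> \<delta> g $ \<Lambda> x \<le> g $ \<Lambda> x + \<delta> * (Q *v (\<chi> x. g $ \<Lambda> x)) $ x"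
    and "\<exists>x. \<Lambda> x = xh \<and> lower_step Q \<Lambda> \<delta> g $ xh = g $ \<Lambda> x + \<delta> * (Q *v (\<chi> x. g $ \<Lambda> x)) $ x"
proof -
  \<comment> \<open>Grouping states by fibres identifies the expression being minimised with
    \<open>Q\<close> applied to the lift of \<open>g\<close>.\<close>
  have sum: "(\<Sum>yh\<in>UNIV. g $ yh * (\<Sum>y\<in>fibre \<Lambda> yh. Q $ x $ y)) = (Q *v (\<chi> x. g $ \<Lambda> x)) $ x" for x
  proof -
    have "(\<Sum>yh\<in>UNIV. g $ yh * (\<Sum>y\<in>fibre \<Lambda> yh. Q $ x $ y))
        = (\<Sum>yh\<in>UNIV. \<Sum>y\<in>{y \<in> UNIV. \<Lambda> y = yh}. Q $ x $ y * g $ \<Lambda> y)"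
      by (auto simp: fibre_def sum_distrib_left mult.commute intro!: sum.cong)
    also have "\<dots> = (\<Sum>y\<in>UNIV. Q $ x $ y * g $ \<Lambda> y)"
      by (rule sum.group) auto
    finally show ?thesis by (simp add: matrix_vector_mult_def)
  qed
  show "lower_step Q \<Lambda> \<delta> g $ \<Lambda> x \<le> g $ \<Lambda> x + \<delta> * (Q *v (\<chi> x. g $ \<Lambda> x)) $ x"
    using assms(2)
    by (auto simp: lower_step_def lower_rate_def sum intro!: mult_left_mono Min_le)
      (auto simp: fibre_def)
  \<comment> \<open>Surjectivity makes the fibre non-empty, so the minimum is attained.\<close>
  have "lower_rate Q \<Lambda> g $ xh \<in> (\<lambda>x. (Q *v (\<chi> x. g $ \<Lambda> x)) $ x) ` fibre \<Lambda> xh"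
    unfolding lower_rate_def sum vec_lambda_beta
    using surjD[OF assms(1), of xh] by (intro Min_in) (auto simp: fibre_def)
  then show "\<exists>x. \<Lambda> x = xh \<and> lower_step Q \<Lambda> \<delta> g $ xh = g $ \<Lambda> x + \<delta> * (Q *v (\<chi> x. g $ \<Lambda> x)) $ x"
    by (auto simp: lower_step_def fibre_def)
qed

text \<open>The bound on \<open>\<delta>\<close> keeps the diagonal entries non-negative; rows sum
  to 1 because those of \<open>Q\<close> sum to 0.\<close>

lemma stochastic_uniformization:
  fixes Q :: "real^'x^'x"
  assumes Q: "transition_rate_matrix Q" and \<delta>: "0 < \<delta>" "\<delta> * (MAX x. \<bar>Q $ x $ x\<bar>) < 1"
  shows "stochastic (mat 1 + \<delta> *\<^sub>R Q)"
  unfolding stochastic_def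
proof (intro conjI allI)
  fix x y
  have "\<delta> * \<bar>Q $ x $ x\<bar> \<le> \<delta> * (MAX x. \<bar>Q $ x $ x\<bar>)"
    using \<delta>(1) by (intro mult_left_mono Max_ge) auto
  then have "- (\<delta> * Q $ x $ x) < 1"
    using \<delta> abs_ge_minus_self[of "\<delta> * Q $ x $ x"] abs_mult_pos'[of \<delta> "Q $ x $ x"] by linarith
  then show "0 \<le> (mat 1 + \<delta> *\<^sub>R Q) $ x $ y"
    using Q \<delta> by (auto simp: mat_def transition_rate_matrix_def)
  show "(\<Sum>y\<in>UNIV. (mat 1 + \<delta> *\<^sub>R Q) $ x $ y) = 1"
    using Q sum_distrib_left[of \<delta> "\<lambda>y. Q $ x $ y" UNIV]
    by (simp add: mat_def transition_rate_matrix_def sum.distrib)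
qed

text \<open>At a minimiser \<open>x\<close> in the fibre, the new value at \<open>xh\<close> is an
  entry of a stochastic matrix applied to the lift of \<open>g\<close>, hence an average of values
  of \<open>g\<close>.\<close>

lemma min_comp_le_lower_step:
  assumes "surj \<Lambda>" "transition_rate_matrix Q" "0 < \<delta>" "\<delta> * (MAX x. \<bar>Q $ x $ x\<bar>) < 1"
  shows "min_comp g \<le> min_comp (lower_step Q \<Lambda> \<delta> g)"
proof (rule min_comp_greatest)
  fix xh
  let ?g = "\<chi> x. g $ \<Lambda> x" and ?P = "mat 1 + \<delta> *\<^sub>R Q"
  obtain x where x: "lower_step Q \<Lambda> \<delta> g $ xh = g $ \<Lambda> x + \<delta> * (Q *v ?g) $ x"
    using lower_step_nth(2)[OF assms(1), of \<delta>] assms(3) by (metis less_imp_le)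
  have "min_comp g \<le> min_comp ?g"
    by (rule min_comp_greatest) (simp add: min_comp_le)
  also have "\<dots> \<le> min_comp (?P *v ?g)"
    by (rule stochastic_min_comp_mono[OF stochastic_uniformization[OF assms(2-4)]])
  also have "\<dots> \<le> (?P *v ?g) $ x"
    by (rule min_comp_le)
  also have "\<dots> = lower_step Q \<Lambda> \<delta> g $ xh"
    by (simp add: x matrix_vector_mult_add_rdistrib scaleR_matrix_vector_assoc[symmetric])
  finally show "min_comp g \<le> lower_step Q \<Lambda> \<delta> g $ xh" .
qed

text \<open>Here \<open>c\<close> is the limit belonging to the lift of \<open>g\<close>. A step
  changes the function and with it the limit, so the induction generalises over both.\<close>

lemma lower_step_iterate_bound:
  assumes Q: "transition_rate_matrix Q" "irreducible_rates Q"
    and "surj \<Lambda>" "0 \<le> \<delta>"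
    and "((\<lambda>t. (transition_matrix Q t *v (\<chi> x. g $ \<Lambda> x)) $ x) \<longlongrightarrow> c) at_top"
  shows "min_comp ((lower_step Q \<Lambda> \<delta> ^^ n) g) \<le> c"
  using assms(5)
proof (induction n arbitrary: g c)
  case 0
  have "min_comp g \<le> min_comp (\<chi> x. g $ \<Lambda> x)"
    by (rule min_comp_greatest) (simp add: min_comp_le)
  then have "min_comp g \<le> (transition_matrix Q t *v (\<chi> x. g $ \<Lambda> x)) $ x" if "0 \<le> t" for t
    using stochastic_min_comp_mono[OF stochastic_transition_matrix[OF Q that], of "\<chi> x. g $ \<Lambda> x"]
      min_comp_le[of "transition_matrix Q t *v (\<chi> x. g $ \<Lambda> x)" x]
    by linarith
  then show ?case
    by (intro tendsto_lowerbound[OF 0]) (auto simp: eventually_at_top_linorder)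
next
  case (Suc n)
  let ?T = "transition_matrix Q" and ?g = "\<chi> x. g $ \<Lambda> x"
  let ?h = "\<chi> x. lower_step Q \<Lambda> \<delta> g $ \<Lambda> x"
  obtain d where d: "((\<lambda>t. (?T t *v ?h) $ x) \<longlongrightarrow> d) at_top"
    using transition_matrix_tendsto[OF Q] by blast
  \<comment> \<open>The function is the semigroup applied to
    \<open>?g + \<delta> *\<^sub>R (Q *v ?g)\<close>, which dominates \<open>?h\<close>; its rate
    term vanishes in the limit, giving \<open>d \<le> c\<close>.\<close>
  have "((\<lambda>t. (?T t *v ?g) $ x + \<delta> * (?T t *v (Q *v ?g)) $ x) \<longlongrightarrow> c + \<delta> * 0) at_top"
    by (intro tendsto_intros Suc.prems transition_matrix_rate_tendsto_0[OF Q])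
  moreover have "(?T t *v ?h) $ x \<le> (?T t *v ?g) $ x + \<delta> * (?T t *v (Q *v ?g)) $ x" if "0 \<le> t" for t
  proof -
    have "(?T t *v ?h) $ x \<le> (\<Sum>y\<in>UNIV. ?T t $ x $ y * (?g $ y + \<delta> * (Q *v ?g) $ y))"
      unfolding matrix_vector_mult_def[of "?T t"] vec_lambda_beta
      using lower_step_nth(1)[OF assms(3,4)] stochastic_transition_matrix[OF Q that]
      by (intro sum_mono mult_left_mono) (auto simp: stochastic_def)
    also have "\<dots> = (?T t *v ?g) $ x + \<delta> * (?T t *v (Q *v ?g)) $ x"
      by (simp add: matrix_vector_mult_def[of "?T t"] distrib_left sum.distrib sum_distrib_left mult_ac)
    finally show ?thesis .
  qed
  ultimately have "d \<le> c + \<delta> * 0"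
    using d by (intro tendsto_le[OF trivial_limit_at_top_linorder])
      (auto simp: eventually_at_top_linorder)
  \<comment> \<open>The first of the \<open>Suc n\<close> steps is peeled off, so the induction
    hypothesis applies to the lower step of \<open>g\<close>.\<close>
  then show ?case
    using Suc.IH[OF d] by (simp add: funpow_swap1 del: funpow.simps add: funpow_Suc_right)
qed

section \<open>Law of the process and the limit expectation\<close>

context homogeneous_markov_chain
begin

lemma state_event:
  assumes "0 \<le> t"
  shows "{\<omega> \<in> space M. X t \<omega> = x} \<in> events"
  using measurable_sets[OF random_variable[OF assms], of "{x}"]
  by (simp add: vimage_def Int_def conj_commute)

lemma prob_state:
  assumes "0 \<le> t"
  shows "\<P>(\<omega> in M. X t \<omega> = y) = (\<Sum>x\<in>UNIV. pmf \<pi>0 x * transition_matrix Q t $ x $ y)"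
proof -
  have joint: "\<P>(\<omega> in M. X t \<omega> = y \<and> X 0 \<omega> = x) = pmf \<pi>0 x * transition_matrix Q t $ x $ y" for x
  proof (cases "pmf \<pi>0 x = 0")
    \<comment> \<open>Conditioning is impossible here, but both sides vanish.\<close>
    case True
    have "\<P>(\<omega> in M. X t \<omega> = y \<and> X 0 \<omega> = x) \<le> \<P>(\<omega> in M. X 0 \<omega> = x)"
      by (rule finite_measure_mono) (auto intro: state_event)
    then show ?thesis using True initial[of x] by (simp add: measure_le_0_iff)
  next
    case False
    then have "0 < \<P>(\<omega> in M. X 0 \<omega> = x)"
      using initial[of x] pmf_nonneg[of \<pi>0 x] by linarith
    then have "\<P>(\<omega> in M. X t \<omega> = y \<bar> X 0 \<omega> = x) = transition_matrix Q t $ x $ y"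
      \<comment> \<open>The present is time 0 and the history empty, so its values can be
        \<open>undefined\<close>.\<close>
      using markov[of "{}" 0 t x undefined y] assms by simp
    then show ?thesis
      using False by (simp add: cond_prob_def initial field_simps)
  qed
  have "\<P>(\<omega> in M. X t \<omega> = y) = measure M (\<Union>x\<in>UNIV. {\<omega> \<in> space M. X t \<omega> = y \<and> X 0 \<omega> = x})"
    by (rule arg_cong[of _ _ "measure M"]) auto
  also have "\<dots> = (\<Sum>x\<in>UNIV. \<P>(\<omega> in M. X t \<omega> = y \<and> X 0 \<omega> = x))"
    using assms by (intro finite_measure_finite_Union)
      (auto simp: disjoint_family_on_def intro!: sets.sets_Collect_conj state_event)
  finally show ?thesis by (simp add: joint)
qed

text \<open>The integrand is a finite combination of indicators of state events, whose probabilities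
  are known.\<close>

lemma expectation_state:
  fixes f :: "real^'x"
  assumes "0 \<le> t"
  shows "expectation (\<lambda>\<omega>. f $ X t \<omega>) = (\<Sum>x\<in>UNIV. pmf \<pi>0 x * (transition_matrix Q t *v f) $ x)"
proof -
  have "expectation (\<lambda>\<omega>. f $ X t \<omega>)
      = expectation (\<lambda>\<omega>. \<Sum>y\<in>UNIV. f $ y * indicator {\<omega> \<in> space M. X t \<omega> = y} \<omega>)"
    by (intro Bochner_Integration.integral_cong) (auto simp: indicator_def if_distrib cong: if_cong)
  also have "\<dots> = (\<Sum>y\<in>UNIV. f $ y * \<P>(\<omega> in M. X t \<omega> = y))"
    by (subst Bochner_Integration.integral_sum)
      (auto simp: state_event[OF assms] Int_absorb2
        intro!: integrable_mult_right integrable_real_indicator emeasure_finite simp flip: less_top)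
  also have "\<dots> = (\<Sum>y\<in>UNIV. \<Sum>x\<in>UNIV. pmf \<pi>0 x * (transition_matrix Q t $ x $ y * f $ y))"
    by (simp add: prob_state[OF assms] sum_distrib_left mult_ac)
  also have "\<dots> = (\<Sum>x\<in>UNIV. pmf \<pi>0 x * (transition_matrix Q t *v f) $ x)"
    by (subst sum.swap) (simp add: matrix_vector_mult_def sum_distrib_left)
  finally show ?thesis .
qed

text \<open>As \<open>c\<close> is the same for every starting state, averaging over
  \<open>\<pi>0\<close> leaves it unchanged.\<close>

lemma limit_expectation_eq:
  assumes "\<And>x. ((\<lambda>t. (transition_matrix Q t *v f) $ x) \<longlongrightarrow> c) at_top"
  shows "limit_expectation M X f = c"
proof -
  have "((\<lambda>t. \<Sum>x\<in>UNIV. pmf \<pi>0 x * (transition_matrix Q t *v f) $ x)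
      \<longlongrightarrow> (\<Sum>x\<in>UNIV. pmf \<pi>0 x * c)) at_top"
    by (intro tendsto_intros assms)
  also have "(\<Sum>x\<in>UNIV. pmf \<pi>0 x * c) = c"
    by (simp add: sum_pmf_eq_1 flip: sum_distrib_right)
  finally have "((\<lambda>t. expectation (\<lambda>\<omega>. f $ X t \<omega>)) \<longlongrightarrow> c) at_top"
    by (rule Lim_transform_eventually)
      (auto simp: eventually_at_top_linorder expectation_state intro!: exI[of _ 0])
  then show ?thesis
    unfolding limit_expectation_def by (rule tendsto_Lim[OF trivial_limit_at_top_linorder])
qed

end

theorem theorem2:
  fixes M :: "'w measure" and X :: "real \<Rightarrow> 'w \<Rightarrow> 'x::finite"
    and Q :: "real^'x^'x" and \<pi>0 :: "'x pmf"
    and \<Lambda> :: "'x \<Rightarrow> 'y::finite" and f :: "real^'x" and fh :: "real^'y" and \<delta> :: real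
  assumes "homogeneous_markov_chain M X Q \<pi>0"
    and "irreducible_rates Q"
    and "lumping_map \<Lambda>"
    and "\<And>x. f $ x = fh $ \<Lambda> x"
    and "0 < \<delta>" and "\<delta> * (MAX x. \<bar>Q $ x $ x\<bar>) < 1"
  defines "lower \<equiv> \<lambda>n. min_comp ((lower_step Q \<Lambda> \<delta> ^^ n) fh)"
    and "upper \<equiv> \<lambda>n. - min_comp ((lower_step Q \<Lambda> \<delta> ^^ n) (- fh))"
  shows "(\<forall>n. lower n \<le> limit_expectation M X f \<and> limit_expectation M X f \<le> upper n) \<and>
    incseq lower \<and> decseq upper \<and> convergent lower \<and> convergent upper"
proof -
  interpret homogeneous_markov_chain M X Q \<pi>0 by fact
  have surj: "surj \<Lambda>" using assms(3) by (simp add: lumping_map_def)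
  obtain c where c: "\<And>x. ((\<lambda>t. (transition_matrix Q t *v f) $ x) \<longlongrightarrow> c) at_top"
    using transition_matrix_tendsto[OF rate_matrix assms(2)] by blast
  have E: "limit_expectation M X f = c"
    by (rule limit_expectation_eq[OF c])
  have f: "(\<chi> x. fh $ \<Lambda> x) = f" "(\<chi> x. (- fh) $ \<Lambda> x) = - f"
    by (simp_all add: vec_eq_iff assms(4))
  note bound = lower_step_iterate_bound[OF rate_matrix assms(2) surj less_imp_le[OF assms(5)]]
  have lower: "lower n \<le> c" for n
    unfolding lower_def by (rule bound[where x = undefined]) (simp only: f c)
  \<comment> \<open>The lift of \<open>- fh\<close> is \<open>- f\<close>, whose limit is
    \<open>- c\<close>.\<close>
  have "- upper n \<le> - c" for n
    unfolding upper_def minus_minus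
    by (rule bound[where x = undefined])
      (unfold f, unfold matrix_vector_mult_minus vector_uminus_component, intro tendsto_minus c)
  then have upper: "c \<le> upper n" for n by simp
  have inc: "incseq (\<lambda>n. min_comp ((lower_step Q \<Lambda> \<delta> ^^ n) g))" for g
    by (rule incseq_SucI)
      (simp add: min_comp_le_lower_step[OF surj rate_matrix assms(5,6)])
  have "incseq lower" "decseq upper"
    using inc[of fh] inc[of "- fh"] by (auto simp: lower_def upper_def monotone_on_def)
  \<comment> \<open>Each monotone sequence is bounded by \<open>c\<close> on the side towards which
    it moves.\<close>
  moreover have "convergent lower"
    using incseq_convergent[OF \<open>incseq lower\<close>] lower by (metis convergentI)
  moreover have "convergent upper"
    using decseq_convergent[OF \<open>decseq upper\<close>] upper by (metis convergentI)
  ultimately show ?thesis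
    using lower upper by (simp add: E)
qed

end
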